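(* For each $i\in I$ let $\mathbf S_i=(S_i,\wedge,0)$ be a meet-semilattice with least element $0$, and let $\prod_{i\in I}\mathbf S_i$ be their direct product (a meet-semilattice with componentwise meet and least element $0=(0)_{i\in I}$). Then the closed subsets of $\prod_{i\in I}S_i$ are exactly the sets $\prod_{i\in I}A_i$ with $A_i\in\mathrm{Cl}(\mathbf S_i)$ for all $i$, and $\mathbf{Cl}(\prod_{i\in I}\mathbf S_i)\cong\prod_{i\in I}\mathbf{Cl}(\mathbf S_i)$ via $(A_i)_{i\in I}\mapsto\prod_{i\in I}A_i$.
   Context: For a meet-semilattice $\mathbf S=(S,\wedge,0)$ with least element $0$, the orthogonality relation is $x\perp y$ iff $x\wedge y=0$. For $A\subseteq S$, $A^\perp:=\{x\in S\mid x\perp y\text{ for all }y\in A\}$. A subset $A$ is closed if $A^{\perp\perp}=A$; $\mathrm{Cl}(\mathbf S)$ is the set of closed subsets of $S$ and $\mathbf{Cl}(\mathbf S)=(\mathrm{Cl}(\mathbf S),\subseteq)$. *)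

theory Defs
  imports "HOL-Algebra.Lattice" "HOL-Library.FuncSet"
begin

definition orthogonal :: "('a, 'b) gorder_scheme \<Rightarrow> 'a \<Rightarrow> 'a \<Rightarrow> bool" where
  "orthogonal L x y \<longleftrightarrow> x \<sqinter>\<^bsub>L\<^esub> y = \<bottom>\<^bsub>L\<^esub>"

definition orth_compl :: "('a, 'b) gorder_scheme \<Rightarrow> 'a set \<Rightarrow> 'a set" where
  "orth_compl L A = {x \<in> carrier L. \<forall>y\<in>A. orthogonal L x y}"

definition closed_subsets :: "('a, 'b) gorder_scheme \<Rightarrow> 'a set set" where
  "closed_subsets L = {A. A \<subseteq> carrier L \<and> orth_compl L (orth_compl L A) = A}"

definition closed_order :: "('a, 'b) gorder_scheme \<Rightarrow> 'a set gorder" where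
  "closed_order L = \<lparr>carrier = closed_subsets L, eq = (=), le = (\<subseteq>)\<rparr>"

definition prod_order :: "'i set \<Rightarrow> ('i \<Rightarrow> ('a, 'b) gorder_scheme) \<Rightarrow> ('i \<Rightarrow> 'a) gorder" where
  "prod_order I L =
    \<lparr>carrier = (\<Pi>\<^sub>E i\<in>I. carrier (L i)), eq = (=),
     le = (\<lambda>f g. \<forall>i\<in>I. f i \<sqsubseteq>\<^bsub>L i\<^esub> g i)\<rparr>"

definition order_iso ::
    "('a, 'c) gorder_scheme \<Rightarrow> ('b, 'd) gorder_scheme \<Rightarrow> ('a \<Rightarrow> 'b) \<Rightarrow> bool" where
  "order_iso A B f \<longleftrightarrow> order_emb A B f \<and> bij_betw f (carrier A) (carrier B)"

text \<open>
  HOL-Algebra derives the meet and the least element from the order. The facts below show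
  that, for meet-semilattices with least element, \<^const>\<open>prod_order\<close> is their direct product
  as algebras: it is again such a semilattice, and both operations are componentwise.
\<close>

lemma partial_order_prod_order:
  assumes "\<And>i. i \<in> I \<Longrightarrow> partial_order (L i)"
  shows "partial_order (prod_order I L)"
proof -
  have refl: "x \<sqsubseteq>\<^bsub>L i\<^esub> x" if "i \<in> I" "x \<in> carrier (L i)" for i x
    by (rule weak_partial_order.le_refl[OF partial_order.axioms(1)[OF assms]]) (fact that)+
  have antisym: "x = y" if "i \<in> I" "x \<in> carrier (L i)" "y \<in> carrier (L i)"
    "x \<sqsubseteq>\<^bsub>L i\<^esub> y" "y \<sqsubseteq>\<^bsub>L i\<^esub> x" for i x y
    by (rule partial_order.le_antisym[OF assms]) (fact that)+
  have trans: "x \<sqsubseteq>\<^bsub>L i\<^esub> z" if "i \<in> I" "x \<in> carrier (L i)" "y \<in> carrier (L i)"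
    "z \<in> carrier (L i)" "x \<sqsubseteq>\<^bsub>L i\<^esub> y" "y \<sqsubseteq>\<^bsub>L i\<^esub> z" for i x y z
    by (rule weak_partial_order.le_trans[OF partial_order.axioms(1)[OF assms], of i x y z]) (fact that)+
  have le: "f \<sqsubseteq>\<^bsub>prod_order I L\<^esub> g \<longleftrightarrow> (\<forall>i\<in>I. f i \<sqsubseteq>\<^bsub>L i\<^esub> g i)"
    and mem: "f \<in> carrier (prod_order I L) \<Longrightarrow> i \<in> I \<Longrightarrow> f i \<in> carrier (L i)"
    and eq: "(.=\<^bsub>prod_order I L\<^esub>) = (=)" for f g i
    by (auto simp: prod_order_def)
  show ?thesis
  proof (unfold_locales, unfold eq le)
    fix f g
    assume "\<forall>i\<in>I. f i \<sqsubseteq>\<^bsub>L i\<^esub> g i" "\<forall>i\<in>I. g i \<sqsubseteq>\<^bsub>L i\<^esub> f i"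
      and fg: "f \<in> carrier (prod_order I L)" "g \<in> carrier (prod_order I L)"
    then have "f i = g i" if "i \<in> I" for i
      using antisym mem that by blast
    then show "f = g"
      using fg unfolding prod_order_def by (auto intro: PiE_ext)
  next
    fix f g h
    assume "\<forall>i\<in>I. f i \<sqsubseteq>\<^bsub>L i\<^esub> g i" "\<forall>i\<in>I. g i \<sqsubseteq>\<^bsub>L i\<^esub> h i"
      and "f \<in> carrier (prod_order I L)" "g \<in> carrier (prod_order I L)"
        "h \<in> carrier (prod_order I L)"
    then show "\<forall>i\<in>I. f i \<sqsubseteq>\<^bsub>L i\<^esub> h i"
      by (intro ballI, rule_tac y = "g i" in trans) (simp_all add: mem)
  qed (simp_all add: refl mem)
qed

lemma greatest_meet_prod_order:
  assumes sl: "\<And>i. i \<in> I \<Longrightarrow> lower_semilattice (L i)"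
    and f: "f \<in> carrier (prod_order I L)" and g: "g \<in> carrier (prod_order I L)"
  shows "greatest (prod_order I L) (\<lambda>i\<in>I. f i \<sqinter>\<^bsub>L i\<^esub> g i) (Lower (prod_order I L) {f, g})"
proof -
  have wsl: "weak_lower_semilattice (L i)" if "i \<in> I" for i
  proof -
    interpret lower_semilattice "L i" using sl that .
    show ?thesis by unfold_locales
  qed
  have mem: "f i \<in> carrier (L i)" "g i \<in> carrier (L i)" if "i \<in> I" for i
    using f g that by (auto simp: prod_order_def)
  note meet = weak_lower_semilattice.meet_closed[OF wsl] weak_lower_semilattice.meet_left[OF wsl]
    weak_lower_semilattice.meet_right[OF wsl] weak_lower_semilattice.meet_le[OF wsl]
  show ?thesis
  proof (rule greatest_LowerI)
    show "(\<lambda>i\<in>I. f i \<sqinter>\<^bsub>L i\<^esub> g i) \<sqsubseteq>\<^bsub>prod_order I L\<^esub> x" if "x \<in> {f, g}" for x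
      using that by (auto simp: prod_order_def mem meet)
    show "y \<sqsubseteq>\<^bsub>prod_order I L\<^esub> (\<lambda>i\<in>I. f i \<sqinter>\<^bsub>L i\<^esub> g i)"
      if "y \<in> Lower (prod_order I L) {f, g}" for y
      using that f g by (auto simp: prod_order_def Lower_def intro!: meet(4) mem)
    show "{f, g} \<subseteq> carrier (prod_order I L)" using f g by simp
    show "(\<lambda>i\<in>I. f i \<sqinter>\<^bsub>L i\<^esub> g i) \<in> carrier (prod_order I L)"
      by (auto simp: prod_order_def mem meet)
  qed
qed

lemma lower_semilattice_prod_order:
  assumes "\<And>i. i \<in> I \<Longrightarrow> lower_semilattice (L i)"
  shows "lower_semilattice (prod_order I L)"
proof -
  interpret partial_order "prod_order I L"
    by (rule partial_order_prod_order) (rule lower_semilattice.axioms(1)[OF assms])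
  show ?thesis
    by unfold_locales (rule exI, rule greatest_meet_prod_order[OF assms])
qed

lemma meet_prod_order:
  assumes "\<And>i. i \<in> I \<Longrightarrow> lower_semilattice (L i)"
    and "f \<in> carrier (prod_order I L)" and "g \<in> carrier (prod_order I L)"
  shows "f \<sqinter>\<^bsub>prod_order I L\<^esub> g = (\<lambda>i\<in>I. f i \<sqinter>\<^bsub>L i\<^esub> g i)"
proof -
  interpret partial_order "prod_order I L"
    by (rule partial_order_prod_order) (rule lower_semilattice.axioms(1)[OF assms(1)])
  have G: "greatest (prod_order I L) (\<lambda>i\<in>I. f i \<sqinter>\<^bsub>L i\<^esub> g i) (Lower (prod_order I L) {f, g})"
    using assms by (rule greatest_meet_prod_order)
  have "greatest (prod_order I L) (f \<sqinter>\<^bsub>prod_order I L\<^esub> g) (Lower (prod_order I L) {f, g})"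
    using someI[of "\<lambda>x. greatest (prod_order I L) x (Lower (prod_order I L) {f, g})", OF G]
    by (simp add: meet_def inf_def)
  then show ?thesis
    using G weak_greatest_unique unfolding eq_is_equal by blast
qed

lemma least_bottom_prod_order:
  assumes "\<And>i. i \<in> I \<Longrightarrow> weak_partial_order_bottom (L i)"
  shows "least (prod_order I L) (\<lambda>i\<in>I. \<bottom>\<^bsub>L i\<^esub>) (carrier (prod_order I L))"
  using weak_partial_order_bottom.bottom_closed[OF assms]
    weak_partial_order_bottom.bottom_lower[OF assms]
  by (auto simp: least_def prod_order_def dest: PiE_mem)

lemma weak_partial_order_bottom_prod_order:
  assumes "\<And>i. i \<in> I \<Longrightarrow> partial_order (L i)"
    and "\<And>i. i \<in> I \<Longrightarrow> weak_partial_order_bottom (L i)"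
  shows "weak_partial_order_bottom (prod_order I L)"
proof -
  interpret partial_order "prod_order I L"
    using assms(1) by (rule partial_order_prod_order)
  show ?thesis
    by unfold_locales (rule exI, rule least_bottom_prod_order[OF assms(2)])
qed

lemma bottom_prod_order:
  assumes "\<And>i. i \<in> I \<Longrightarrow> partial_order (L i)"
    and "\<And>i. i \<in> I \<Longrightarrow> weak_partial_order_bottom (L i)"
  shows "\<bottom>\<^bsub>prod_order I L\<^esub> = (\<lambda>i\<in>I. \<bottom>\<^bsub>L i\<^esub>)"
proof -
  interpret partial_order "prod_order I L"
    using assms(1) by (rule partial_order_prod_order)
  interpret weak_partial_order_bottom "prod_order I L"
    using assms by (rule weak_partial_order_bottom_prod_order)
  show ?thesis
    using weak_least_unique[OF bottom_least least_bottom_prod_order[OF assms(2)]]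
    unfolding eq_is_equal by simp
qed

end

theory Submission
  imports Defs
begin

text \<open>
  Orthogonality in a product is componentwise, so \<open>B\<^sup>\<bottom>\<close> is the product of the sets
  \<open>(\<pi>\<^sub>i B)\<^sup>\<bottom>\<close> for every set \<open>B\<close> of families. Orthocomplements contain \<open>0\<close>, so a product of
  them is nonempty and projects onto each of its factors; hence \<open>\<bottom>\<bottom>\<close> can be computed factorwise.
\<close>

lemma orth_compl_subset: "orth_compl L A \<subseteq> carrier L"
  by (auto simp: orth_compl_def)

lemma orth_compl_antimono: "A \<subseteq> B \<Longrightarrow> orth_compl L B \<subseteq> orth_compl L A"
  by (auto simp: orth_compl_def)

lemma orthogonal_sym: "orthogonal L x y \<Longrightarrow> orthogonal L y x"
  by (simp add: orthogonal_def meet_comm)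

lemma subset_orth_compl_twice: "A \<subseteq> carrier L \<Longrightarrow> A \<subseteq> orth_compl L (orth_compl L A)"
  unfolding orth_compl_def by (blast intro: orthogonal_sym)

text \<open>Three complements collapse to one: applying the antitone complement to \<open>A\<close>
  inside its double complement gives one inclusion, and extensivity at \<open>orth_compl L A\<close>
  gives the other.\<close>

lemma orth_compl_closed:
  assumes "A \<subseteq> carrier L"
  shows "orth_compl L A \<in> closed_subsets L"
  using orth_compl_antimono[OF subset_orth_compl_twice[OF assms], of L]
    subset_orth_compl_twice[OF orth_compl_subset, of L A] orth_compl_subset[of L A]
  by (simp add: closed_subsets_def subset_antisym)

lemma orthogonal_bottom_left:
  assumes "lower_semilattice L" "weak_partial_order_bottom L" "y \<in> carrier L"
  shows "orthogonal L \<bottom>\<^bsub>L\<^esub> y"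
proof -
  interpret lower_semilattice L by fact
  interpret weak_partial_order_bottom L by fact
  show ?thesis
    unfolding orthogonal_def
    using assms(3) by (intro le_antisym meet_left bottom_lower meet_closed bottom_closed)
qed

lemma bottom_in_orth_compl:
  assumes "lower_semilattice L" "weak_partial_order_bottom L" "A \<subseteq> carrier L"
  shows "\<bottom>\<^bsub>L\<^esub> \<in> orth_compl L A"
  using assms orthogonal_bottom_left[OF assms(1,2)]
    weak_partial_order_bottom.bottom_closed[OF assms(2)]
  by (auto simp: orth_compl_def)

text \<open>A closed set is itself an orthocomplement, namely that of \<open>orth_compl L A\<close>.
  So closed sets are never empty.\<close>

lemma bottom_in_closed:
  assumes "lower_semilattice L" "weak_partial_order_bottom L" "A \<in> closed_subsets L"
  shows "\<bottom>\<^bsub>L\<^esub> \<in> A"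
  using bottom_in_orth_compl[OF assms(1,2) orth_compl_subset, of A] assms(3)
  by (simp add: closed_subsets_def)

lemma closed_order_simps [simp]:
  "carrier (closed_order L) = closed_subsets L"
  "A \<sqsubseteq>\<^bsub>closed_order L\<^esub> B \<longleftrightarrow> A \<subseteq> B"
  by (simp_all add: closed_order_def)

lemma partial_order_closed_order: "partial_order (closed_order L)"
  by unfold_locales (auto simp: closed_order_def)

lemma prod_order_simps [simp]:
  "carrier (prod_order I L) = (\<Pi>\<^sub>E i\<in>I. carrier (L i))"
  "f \<sqsubseteq>\<^bsub>prod_order I L\<^esub> g \<longleftrightarrow> (\<forall>i\<in>I. f i \<sqsubseteq>\<^bsub>L i\<^esub> g i)"
  by (simp_all add: prod_order_def)

lemma projection_PiE:
  assumes "PiE I A \<noteq> {}" "i \<in> I"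
  shows "(\<lambda>f. f i) ` PiE I A = A i"
proof
  show "A i \<subseteq> (\<lambda>f. f i) ` PiE I A"
  proof
    fix a assume "a \<in> A i"
    moreover obtain f where "f \<in> PiE I A" using assms(1) by blast
    \<comment> \<open>Any member of the product can be overwritten at \<open>i\<close> by the given
      value without leaving the product; nonemptiness supplies such a member.\<close>
    ultimately have "f(i := a) \<in> PiE I A"
      using assms(2) by (auto simp: PiE_iff extensional_def)
    then show "a \<in> (\<lambda>f. f i) ` PiE I A" by (rule rev_image_eqI) simp
  qed
qed (use assms(2) in auto)

locale semilattice_family =
  fixes I :: "'i set" and L :: "'i \<Rightarrow> ('a, 'b) gorder_scheme"
  assumes semilattice: "i \<in> I \<Longrightarrow> lower_semilattice (L i)"
    and bottom: "i \<in> I \<Longrightarrow> weak_partial_order_bottom (L i)"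
begin

lemma orthogonal_prod_order_iff:
  assumes "f \<in> carrier (prod_order I L)" "g \<in> carrier (prod_order I L)"
  shows "orthogonal (prod_order I L) f g \<longleftrightarrow> (\<forall>i\<in>I. orthogonal (L i) (f i) (g i))"
proof -
  have "\<bottom>\<^bsub>prod_order I L\<^esub> = (\<lambda>i\<in>I. \<bottom>\<^bsub>L i\<^esub>)"
    by (rule bottom_prod_order) (auto intro: lower_semilattice.axioms(1) semilattice bottom)
  then show ?thesis
    \<comment> \<open>Meet and bottom of the product are both \<open>undefined\<close> outside
      \<open>I\<close>, so their equality only has to be tested at indices in
      \<open>I\<close>.\<close>
    using meet_prod_order[OF semilattice assms]
    by (auto simp: orthogonal_def fun_eq_iff restrict_def)
qed

lemma orth_compl_prod_order:
  assumes "B \<subseteq> carrier (prod_order I L)"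
  shows "orth_compl (prod_order I L) B = (\<Pi>\<^sub>E i\<in>I. orth_compl (L i) ((\<lambda>f. f i) ` B))"
    (is "?l = ?r")
proof -
  have "f \<in> ?l \<longleftrightarrow> f \<in> ?r" for f
  proof (cases "f \<in> carrier (prod_order I L)")
    case True
    then have "f \<in> ?l \<longleftrightarrow> (\<forall>g\<in>B. orthogonal (prod_order I L) f g)"
      by (simp add: orth_compl_def)
    also have "\<dots> \<longleftrightarrow> (\<forall>g\<in>B. \<forall>i\<in>I. orthogonal (L i) (f i) (g i))"
      by (intro ball_cong refl orthogonal_prod_order_iff True subsetD[OF assms])
    \<comment> \<open>Swapping the two quantifiers turns the condition into one per coordinate:
      \<open>f i\<close> is orthogonal to every \<open>i\<close>-th coordinate of a member of
      \<open>B\<close>. This needs no product structure on \<open>B\<close>.\<close>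
    also have "\<dots> \<longleftrightarrow> f \<in> ?r"
      using True by (auto simp: orth_compl_def PiE_iff)
    finally show ?thesis .
  next
    case False
    then show ?thesis by (auto simp: orth_compl_def PiE_iff)
  qed
  then show ?thesis by blast
qed

lemma PiE_nonempty:
  assumes "\<And>i. i \<in> I \<Longrightarrow> A i \<in> closed_subsets (L i)"
  shows "PiE I A \<noteq> {}"
  using bottom_in_closed[OF semilattice bottom assms] by (auto simp: PiE_eq_empty_iff)

text \<open>Closedness makes the product nonempty, so its projection to \<open>i\<close> is all of
  \<open>A i\<close>. With an empty factor the product is empty, its complement is the whole
  carrier, and the equation can fail.\<close>

lemma orth_compl_PiE:
  assumes "\<And>i. i \<in> I \<Longrightarrow> A i \<in> closed_subsets (L i)"
  shows "orth_compl (prod_order I L) (PiE I A) = (\<Pi>\<^sub>E i\<in>I. orth_compl (L i) (A i))"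
proof -
  have "PiE I A \<subseteq> carrier (prod_order I L)"
    unfolding prod_order_simps using assms by (intro PiE_mono) (simp add: closed_subsets_def)
  then show ?thesis
    by (simp add: orth_compl_prod_order projection_PiE[OF PiE_nonempty[OF assms]] cong: PiE_cong)
qed

lemma PiE_closed:
  assumes "\<And>i. i \<in> I \<Longrightarrow> A i \<in> closed_subsets (L i)"
  shows "PiE I A \<in> closed_subsets (prod_order I L)"
proof -
  have A: "A i \<subseteq> carrier (L i)" "orth_compl (L i) (orth_compl (L i) (A i)) = A i" if "i \<in> I" for i
    using assms[OF that] by (auto simp: closed_subsets_def)
  have "orth_compl (prod_order I L) (orth_compl (prod_order I L) (PiE I A)) = PiE I A"
    \<comment> \<open>The factorwise formula is used twice; the second use is legitimate because the
      complements of the \<open>A i\<close> are closed as well.\<close>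
    using assms A by (simp add: orth_compl_PiE orth_compl_closed cong: PiE_cong)
  then show ?thesis
    using A(1) by (simp add: closed_subsets_def PiE_mono)
qed

lemma closed_subset_is_PiE:
  assumes "B \<in> closed_subsets (prod_order I L)"
  obtains A where "A \<in> (\<Pi>\<^sub>E i\<in>I. closed_subsets (L i))" "B = PiE I A"
proof
  define C where "C = orth_compl (prod_order I L) B"
  \<comment> \<open>Since \<open>B\<close> is the complement of \<open>C\<close>, the formula for
    complements of arbitrary sets shows it to be a product and dictates its factors. The restriction
    to \<open>I\<close> makes \<open>A\<close> extensional, as membership in the product of orders
    demands.\<close>
  define A where "A = (\<lambda>i\<in>I. orth_compl (L i) ((\<lambda>f. f i) ` C))"
  have C: "C \<subseteq> carrier (prod_order I L)"
    unfolding C_def by (rule orth_compl_subset)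
  have "B = orth_compl (prod_order I L) C"
    using assms by (simp add: closed_subsets_def C_def)
  also have "\<dots> = PiE I A"
    unfolding orth_compl_prod_order[OF C] A_def by (rule PiE_cong) simp
  finally show "B = PiE I A" .
  show "A \<in> (\<Pi>\<^sub>E i\<in>I. closed_subsets (L i))"
    unfolding A_def using C by (auto intro!: orth_compl_closed)
qed

text \<open>Inclusion of products can be read off the factors because the left product is nonempty.
  This yields both order reflection and injectivity of the isomorphism.\<close>

lemma PiE_subset_iff:
  assumes "\<And>i. i \<in> I \<Longrightarrow> A i \<in> closed_subsets (L i)"
  shows "PiE I A \<subseteq> PiE I B \<longleftrightarrow> (\<forall>i\<in>I. A i \<subseteq> B i)"
  using PiE_nonempty[OF assms] by (simp add: subset_PiE)

text \<open>The families \<open>A\<close> here may take any values outside \<open>I\<close>, since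
  \<open>PiE I A\<close> depends only on the values on \<open>I\<close>.\<close>

lemma closed_subsets_prod_order:
  "closed_subsets (prod_order I L) = {PiE I A | A. \<forall>i\<in>I. A i \<in> closed_subsets (L i)}"
proof
  show "closed_subsets (prod_order I L) \<subseteq> {PiE I A | A. \<forall>i\<in>I. A i \<in> closed_subsets (L i)}"
  proof
    fix B assume "B \<in> closed_subsets (prod_order I L)"
    then show "B \<in> {PiE I A | A. \<forall>i\<in>I. A i \<in> closed_subsets (L i)}"
      by (rule closed_subset_is_PiE) (auto dest: PiE_mem)
  qed
  show "{PiE I A | A. \<forall>i\<in>I. A i \<in> closed_subsets (L i)} \<subseteq> closed_subsets (prod_order I L)"
    using PiE_closed by auto
qed

lemma order_iso_closed_prod_order:
  "order_iso (prod_order I (\<lambda>i. closed_order (L i))) (closed_order (prod_order I L)) (PiE I)"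
  (is "order_iso ?P ?C _")
proof -
  have le: "PiE I A \<sqsubseteq>\<^bsub>?C\<^esub> PiE I B \<longleftrightarrow> A \<sqsubseteq>\<^bsub>?P\<^esub> B" if "A \<in> carrier ?P" for A B
    using that unfolding prod_order_simps closed_order_simps by (blast intro!: PiE_subset_iff)
  have "inj_on (PiE I) (carrier ?P)"
  proof (rule inj_onI)
    fix A B assume AB: "A \<in> carrier ?P" "B \<in> carrier ?P" "PiE I A = PiE I B"
    \<comment> \<open>Equal products include each other, and reflecting both inclusions gives
      equality of all factors.\<close>
    have "A \<sqsubseteq>\<^bsub>?P\<^esub> B" "B \<sqsubseteq>\<^bsub>?P\<^esub> A"
      using le[OF AB(1), of B] le[OF AB(2), of A] AB(3) by simp_all
    then have "A i = B i" if "i \<in> I" for i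
      using that by auto
    with AB(1,2) show "A = B"
      unfolding prod_order_simps by (rule PiE_ext)
  qed
  moreover have "PiE I ` carrier ?P = carrier ?C"
  proof
    show "PiE I ` carrier ?P \<subseteq> carrier ?C"
      by (auto intro!: PiE_closed)
    show "carrier ?C \<subseteq> PiE I ` carrier ?P"
    proof
      fix B assume "B \<in> carrier ?C"
      then obtain A where "A \<in> (\<Pi>\<^sub>E i\<in>I. closed_subsets (L i))" "B = PiE I A"
        using closed_subset_is_PiE by auto
      then show "B \<in> PiE I ` carrier ?P" by simp
    qed
  qed
  \<comment> \<open>Besides the equivalence of the two orders, \<open>order_emb\<close> asks that
    both structures be weak partial orders.\<close>
  moreover have "weak_partial_order ?P"
    by (rule partial_order.axioms(1), rule partial_order_prod_order, rule partial_order_closed_order)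
  moreover have "weak_partial_order ?C"
    by (rule partial_order.axioms(1), rule partial_order_closed_order)
  ultimately show ?thesis
    unfolding order_iso_def order_emb_def bij_betw_def by (intro conjI ballI le)
qed

end

theorem theorem2:
  fixes I :: "'i set" and S :: "'i \<Rightarrow> 'a gorder"
  assumes "\<And>i. i \<in> I \<Longrightarrow> lower_semilattice (S i)"
    and "\<And>i. i \<in> I \<Longrightarrow> weak_partial_order_bottom (S i)"
  shows "closed_subsets (prod_order I S) =
           {\<Pi>\<^sub>E i\<in>I. A i | A. \<forall>i\<in>I. A i \<in> closed_subsets (S i)} \<and>
         order_iso (prod_order I (\<lambda>i. closed_order (S i))) (closed_order (prod_order I S))
           (\<lambda>A. \<Pi>\<^sub>E i\<in>I. A i)"
proof -
  interpret semilattice_family I S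
    using assms by (rule semilattice_family.intro)
  show ?thesis
    using closed_subsets_prod_order order_iso_closed_prod_order by simp
qed

end
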